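(* Let $\lambda$ be an infinite cardinal and let $\lambda'=2^{<\lambda}$. Then $(\lambda')^{<\mathrm{cof}(\lambda)}=\lambda'$, and the space ${}^{\lambda}2$ is homeomorphic to a closed subspace of ${}^{\mathrm{cof}(\lambda)}\lambda'$ (both with the bounded topology).
   Context: For a set $A$ and an ordinal $\gamma$, ${}^{\gamma}A$ is the set of sequences of elements of $A$ of length $\gamma$, with the bounded topology, generated by the cones $\mathbf{N}_s=\{x\in{}^{\gamma}A\mid s\subseteq x\}$ for $s\in{}^{<\gamma}A=\bigcup_{\alpha<\gamma}{}^{\alpha}A$. $\mathrm{cof}(\lambda)$ is the cofinality of $\lambda$, and $\nu^{<\theta}=\sup\{\nu^{\rho}\mid\rho<\theta\text{ a cardinal}\}$ (cardinal exponentiation). *)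

theory Defs
  imports "HOL-Analysis.Abstract_Topology"
begin

unbundle cardinal_syntax

(* As in the BNF cardinal theories of Main, an ordinal is a well-order relation, a cardinal is a
   relation satisfying Card_order (an initial ordinal), and equality of cardinals is =o.  The
   elements a of Field g stand for the ordinals below g: the ordinal of a is underS g a. *)

(* Determined up to =o; the constant cofinal of Main is the strict version ("unbounded in r"),
   which for limit orders, in particular infinite cardinals, agrees with the non-strict one. *)
definition cofinality :: "'a rel \<Rightarrow> 'a rel" where
  "cofinality r =
     |SOME K. K \<subseteq> Field r \<and> cofinal K r \<and> (\<forall>L \<subseteq> Field r. cofinal L r \<longrightarrow> |K| \<le>o |L| )|"

(* Comparing c only with upper bounds d over its own type is no restriction: an upper bound below
   c over any type is order-isomorphic to one over the type of c. *)
definition is_csup :: "'b rel set \<Rightarrow> 'c rel \<Rightarrow> bool" where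
  "is_csup R c \<longleftrightarrow> Card_order c \<and> (\<forall>q\<in>R. q \<le>o c) \<and>
     (\<forall>d :: 'c rel. Card_order d \<and> (\<forall>q\<in>R. q \<le>o d) \<longrightarrow> c \<le>o d)"

(* The cardinal \<nu>^{<\<theta>}, determined up to =o.  Every cardinal below \<theta> is represented by a
   relation over the type of \<theta>. *)
definition cexp_less :: "'b rel \<Rightarrow> 'a rel \<Rightarrow> ('a \<Rightarrow> 'b) rel" where
  "cexp_less \<nu> \<theta> = (SOME c. is_csup {\<nu> ^c \<rho> | \<rho> :: 'a rel. Card_order \<rho> \<and> \<rho> <o \<theta>} c)"

definition cone_set :: "'a rel \<Rightarrow> 'b set \<Rightarrow> 'a \<Rightarrow> ('a \<Rightarrow> 'b) \<Rightarrow> ('a \<Rightarrow> 'b) set" where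
  "cone_set g A a s = {x \<in> Field g \<rightarrow>\<^sub>E A. \<forall>i \<in> underS g a. x i = s i}"

(* The bounded topology on the sequences of length g in A, which are the extensional functions on
   Field g.  The whole space is inserted only for the sake of the empty g, which has no cones. *)
definition bounded_topology :: "'a rel \<Rightarrow> 'b set \<Rightarrow> ('a \<Rightarrow> 'b) topology" where
  "bounded_topology g A = topology_generated_by
     (insert (Field g \<rightarrow>\<^sub>E A)
       {cone_set g A a s | a s. a \<in> Field g \<and> s \<in> underS g a \<rightarrow>\<^sub>E A})"

lemma topspace_bounded_topology: "topspace (bounded_topology g A) = Field g \<rightarrow>\<^sub>E A"
  by (auto simp: bounded_topology_def cone_set_def)

lemma exists_least_card_of:
  assumes "\<exists>A. P A"
  shows "\<exists>A. P A \<and> (\<forall>B. P B \<longrightarrow> |A| \<le>o |B| )"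
proof -
  from assms have "{|A| | A. P A} \<noteq> {}" by blast
  moreover have "\<forall>r \<in> {|A| | A. P A}. Card_order r"
    using card_of_Card_order by blast
  ultimately have "\<exists>r \<in> {|A| | A. P A}. \<forall>r' \<in> {|A| | A. P A}. r \<le>o r'"
    by (intro exists_minim_Card_order)
  then show ?thesis by blast
qed

lemma cofinality_witness:
  assumes "Cinfinite r"
  obtains K where "K \<subseteq> Field r" "cofinal K r" "cofinality r = |K|"
    "\<And>L. L \<subseteq> Field r \<Longrightarrow> cofinal L r \<Longrightarrow> |K| \<le>o |L|"
proof -
  have "cofinal (Field r) r"
    unfolding cofinal_def
  proof
    fix a assume "a \<in> Field r"
    with assms infinite_Card_order_limit[of r a] show "\<exists>b \<in> Field r. a \<noteq> b \<and> (a, b) \<in> r"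
      unfolding cinfinite_def by blast
  qed
  then have "\<exists>K. K \<subseteq> Field r \<and> cofinal K r" by blast
  from exists_least_card_of[where P = "\<lambda>K. K \<subseteq> Field r \<and> cofinal K r", OF this]
  have "\<exists>K. K \<subseteq> Field r \<and> cofinal K r \<and> (\<forall>L \<subseteq> Field r. cofinal L r \<longrightarrow> |K| \<le>o |L| )"
    by blast
  note K = someI_ex[OF this]
  show ?thesis
    by (rule that[OF K[THEN conjunct1] K[THEN conjunct2, THEN conjunct1] cofinality_def[of r]])
      (rule K[THEN conjunct2, THEN conjunct2, rule_format])
qed

lemma is_csup_cexp_less:
  fixes \<nu> :: "'b rel" and \<theta> :: "'a rel"
  shows "is_csup {\<nu> ^c \<rho> | \<rho> :: 'a rel. Card_order \<rho> \<and> \<rho> <o \<theta>} (cexp_less \<nu> \<theta>)"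
proof -
  let ?R = "{\<nu> ^c \<rho> | \<rho> :: 'a rel. Card_order \<rho> \<and> \<rho> <o \<theta>}"
  let ?B = "{c :: ('a \<Rightarrow> 'b) rel. Card_order c \<and> (\<forall>q\<in>?R. q \<le>o c)}"
  have "q \<le>o |UNIV :: ('a \<Rightarrow> 'b) set|" if "q \<in> ?R" for q
    using that unfolding cexp_def by (auto intro: card_of_mono1)
  then have "|UNIV| \<in> ?B"
    using card_of_Card_order by blast
  then have "?B \<noteq> {}" by blast
  moreover have "\<forall>c \<in> ?B. Card_order c" by blast
  ultimately have "\<exists>c \<in> ?B. \<forall>d \<in> ?B. c \<le>o d"
    by (rule exists_minim_Card_order)
  then obtain c where c: "c \<in> ?B" "\<forall>d \<in> ?B. c \<le>o d" by (rule bexE)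
  then have "is_csup ?R c"
    unfolding is_csup_def mem_Collect_eq[of c] Ball_Collect by (simp add: subset_eq)
  then have "\<exists>c. is_csup ?R (c :: ('a \<Rightarrow> 'b) rel)" by (rule exI)
  then show ?thesis unfolding cexp_less_def by (rule someI_ex)
qed

end

theory Submission
  imports Defs
begin

text \<open>
  Let \<open>B\<close> be the family of bounded subsets of \<open>\<lambda>\<close>. Since \<open>\<lambda> \<le> 2\<^sup><\<^sup>\<lambda>\<close>, it has cardinality
  \<open>\<lambda>' = 2\<^sup><\<^sup>\<lambda>\<close>. A function \<open>\<rho> \<rightarrow> B\<close> with \<open>\<rho> < cof(\<lambda>)\<close> takes its values in the power set
  of a single \<open>\<alpha> < \<lambda>\<close>, so there are at most \<open>\<lambda> \<cdot> sup\<^sub>\<alpha> 2\<^bsup>|\<alpha>| \<cdot> \<rho>\<^esup> \<le> \<lambda>'\<close> of them.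
  For the embedding, let \<open>K\<close> be a cofinal subset of \<open>\<lambda>\<close> of least cardinality and map \<open>x\<close> to
  the sequence of its restrictions to the elements of \<open>K\<close>, coded by elements of \<open>\<lambda>'\<close>.
  It does not matter that the well-order \<open>|K|\<close> need not agree with the order of \<open>\<lambda>\<close> on \<open>K\<close>:
  initial segments of \<open>|K|\<close> have fewer than \<open>cof(\<lambda>)\<close> elements and hence are bounded in \<open>\<lambda>\<close>.
  The image is closed because it is cut out by coherence conditions on pairs of coordinates.
\<close>

section \<open>Cardinal arithmetic\<close>

lemma Card_order_Well_order: "Card_order r \<Longrightarrow> Well_order r"
  unfolding card_order_on_def by blast

lemma Card_order_not_ordLeq_iff:
  assumes "Card_order r" "Card_order s"
  shows "\<not> r \<le>o s \<longleftrightarrow> s <o r"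
  using assms by (intro not_ordLeq_iff_ordLess Card_order_Well_order)

lemma card_of_Pow_ctwo: "|Pow X| =o ctwo ^c |X|"
  using card_of_Pow_Func[of X] by (simp add: cexp_def ctwo_def Field_card_of)

text \<open>\<open>is_csup\<close> compares \<open>c\<close> only with bounds over its own type;
  here the bound may live over any type. If \<open>d\<close> were strictly below \<open>c\<close>, a
  copy \<open>D\<close> of its field inside \<open>Field c\<close> would give the smaller bound
  \<open>|D|\<close> over the right type.\<close>

lemma is_csup_least:
  fixes c :: "'c rel" and d :: "'d rel"
  assumes "is_csup R c" and d: "Card_order d" and ub: "\<And>q. q \<in> R \<Longrightarrow> q \<le>o d"
  shows "c \<le>o d"
proof (rule ccontr)
  assume "\<not> c \<le>o d"
  have c: "Card_order c" using assms unfolding is_csup_def by blast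
  have "d <o c"
    using \<open>\<not> c \<le>o d\<close> Card_order_not_ordLeq_iff[OF c d] by blast
  then have "|Field d| <o c"
    using card_of_Field_ordIso[OF d] ordIso_ordLess_trans by blast
  then have "\<exists>D \<subset> Field c. |Field d| =o |D| \<and> |D| <o c"
    by (rule internalize_card_of_ordLess[THEN iffD1])
  then obtain D :: "'c set" where D: "|Field d| =o |D|" "|D| <o c" by blast
  have "d =o |D|"
    using ordIso_transitive[OF ordIso_symmetric[OF card_of_Field_ordIso[OF d]] D(1)] .
  then have "q \<le>o |D|" if "q \<in> R" for q
    using ub[OF that] by (rule ordLeq_ordIso_trans[rotated])
  then have "c \<le>o |D|"
    using assms(1) card_of_Card_order unfolding is_csup_def by blast
  then show False
    using D(2) not_ordLess_ordLeq by blast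
qed

lemma card_of_Times_same_ordLess:
  assumes "Cinfinite r" "|X| <o r"
  shows "|X \<times> X| <o r"
proof (cases "finite X")
  case True
  then have "finite (X \<times> X)" by simp
  then show ?thesis
    using assms(1)
    by (intro Cfinite_ordLess_Cinfinite) (auto simp: cfinite_def Field_card_of card_of_card_order_on)
next
  case False
  then show ?thesis
    using card_of_Times_same_infinite assms(2) ordIso_ordLess_trans by blast
qed

lemma card_of_Pow_ordLeq_cexp_less:
  fixes r :: "'a rel"
  assumes "Card_order r" "|X| <o r"
  shows "|Pow X| \<le>o cexp_less ctwo r"
proof -
  \<comment> \<open>The supremum ranges over exponents over the type of \<open>r\<close>, so
    \<open>X\<close> is first copied into \<open>Field r\<close>.\<close>
  have "\<exists>Y \<subset> Field r. |X| =o |Y| \<and> |Y| <o r"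
    using assms(2) by (rule internalize_card_of_ordLess[THEN iffD1])
  then obtain Y :: "'a set" where Y: "|X| =o |Y|" "|Y| <o r" by blast
  have "|Pow X| =o ctwo ^c |X|"
    by (rule card_of_Pow_ctwo)
  also have "ctwo ^c |X| =o ctwo ^c |Y|"
    using Y(1) by (intro cexp_cong2) (simp_all add: Card_order_ctwo card_of_Card_order)
  finally have "|Pow X| =o ctwo ^c |Y|" .
  moreover have "ctwo ^c |Y| \<le>o cexp_less ctwo r"
    using is_csup_cexp_less[of ctwo r] Y(2) card_of_Card_order unfolding is_csup_def by blast
  ultimately show ?thesis
    using ordIso_ordLeq_trans by blast
qed

text \<open>A concrete set of size \<open>cexp_less ctwo r\<close>: it turns powers of that cardinal
  into sets of functions that can be counted, and its members are what the coordinates of the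
  embedding code.\<close>

definition bounded_subsets :: "'a rel \<Rightarrow> 'a set set" where
  "bounded_subsets r = (\<Union>a\<in>Field r. Pow (underS r a))"

text \<open>Cantor's theorem: if the supremum \<open>c\<close> were below \<open>r\<close>, then 2^c
  would be among the powers it bounds, so 2^c \<le> c.\<close>

lemma ordLeq_cexp_less_ctwo:
  fixes r :: "'a rel"
  assumes "Card_order r"
  shows "r \<le>o cexp_less ctwo r"
proof (rule ccontr)
  let ?c = "cexp_less ctwo r"
  assume "\<not> r \<le>o ?c"
  have c: "Card_order ?c"
    using is_csup_cexp_less[of ctwo r] unfolding is_csup_def by blast
  have "?c <o r"
    using \<open>\<not> r \<le>o ?c\<close> Card_order_not_ordLeq_iff[OF assms c] by blast
  then have "|Field ?c| <o r"
    using card_of_Field_ordIso[OF c] ordIso_ordLess_trans by blast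
  from card_of_Pow_ordLeq_cexp_less[OF assms this]
  have "|Field ?c| <o ?c"
    using card_of_Pow ordLess_ordLeq_trans by blast
  then show False
    using card_of_Field_ordIso[OF c] not_ordLess_ordIso by blast
qed

text \<open>Upper bound: a union of \<open>r\<close> \<le> 2^{<r} many power sets, each of size at
  most 2^{<r}. Lower bound: each cardinal \<rho> below \<open>r\<close> is the size of an initial
  segment, whose power set of size 2^\<rho> is part of the family.\<close>

lemma card_of_bounded_subsets:
  fixes r :: "'a rel"
  assumes r: "Cinfinite r"
  shows "|bounded_subsets r| =o cexp_less ctwo r"
proof (rule ordIso_iff_ordLeq[THEN iffD2], rule conjI)
  let ?c = "cexp_less ctwo r"
  have c: "Card_order ?c"
    using is_csup_cexp_less[of ctwo r] unfolding is_csup_def by blast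
  have rc: "r \<le>o ?c" using ordLeq_cexp_less_ctwo r by blast
  have inf: "\<not> finite (Field ?c)"
    using r cinfinite_mono[OF rc] by (simp add: cinfinite_def)
  show "|bounded_subsets r| \<le>o ?c"
    unfolding bounded_subsets_def
  proof (rule card_of_UNION_ordLeq_infinite_Field[OF inf c])
    show "|Field r| \<le>o ?c"
      using r ordIso_ordLeq_trans[OF card_of_Field_ordIso rc] by blast
    show "\<forall>a\<in>Field r. |Pow (underS r a)| \<le>o ?c"
      using r by (auto intro!: card_of_Pow_ordLeq_cexp_less card_of_underS)
  qed
  show "?c \<le>o |bounded_subsets r|"
  proof (rule is_csup_least[OF is_csup_cexp_less card_of_Card_order])
    fix q assume "q \<in> {ctwo ^c \<rho> | \<rho> :: 'a rel. Card_order \<rho> \<and> \<rho> <o r}"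
    then obtain \<rho> :: "'a rel" where \<rho>: "q = ctwo ^c \<rho>" "Card_order \<rho>" "\<rho> <o r" by blast
    have wo: "Well_order r" "Well_order \<rho>"
      using r \<rho>(2) by (auto intro: Card_order_Well_order)
    obtain a where a: "a \<in> Field r" "\<rho> =o Restr r (underS r a)"
      using \<rho>(3) unfolding ordLess_iff_ordIso_Restr[OF wo] by (rule bexE)
    have "\<rho> =o |Field \<rho>|"
      using card_of_Field_ordIso[OF \<rho>(2)] ordIso_symmetric by blast
    also have "|Field \<rho>| =o |Field (Restr r (underS r a))|"
      using a(2) by (rule card_of_cong)
    also have "Field (Restr r (underS r a)) = underS r a"
      using wo(1) by (intro Field_Restr_ofilter) (auto simp: wo_rel_def intro: wo_rel.underS_ofilter)
    finally have "q =o ctwo ^c |underS r a|"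
      unfolding \<rho>(1) using \<rho>(2) by (intro cexp_cong2) (simp_all add: Card_order_ctwo)
    then have "q =o |Pow (underS r a)|"
      by (rule ordIso_transitive[OF _ ordIso_symmetric[OF card_of_Pow_ctwo]])
    moreover have "|Pow (underS r a)| \<le>o |bounded_subsets r|"
      using a(1) unfolding bounded_subsets_def by (intro card_of_mono1) blast
    ultimately show "q \<le>o |bounded_subsets r|"
      using ordIso_ordLeq_trans by blast
  qed
qed

section \<open>Bounds below the cofinality\<close>

lemma not_cofinal_bound:
  assumes "Card_order r" "L \<subseteq> Field r" "\<not> cofinal L r"
  obtains a where "a \<in> Field r" "\<And>b. b \<in> L \<Longrightarrow> (b, a) \<in> r"
proof -
  have "Well_order r" using assms(1) by (rule Card_order_Well_order)
  then have lin: "total_on (Field r) r" "refl_on (Field r) r"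
    by (auto simp: order_on_defs)
  obtain a where a: "a \<in> Field r" "\<And>b. b \<in> L \<Longrightarrow> a = b \<or> (a, b) \<notin> r"
    using assms(3) unfolding cofinal_def by blast
  have "(b, a) \<in> r" if "b \<in> L" for b
    using a(1) a(2)[OF that] assms(2) that lin
    by (metis refl_on_def subsetD total_on_def)
  with a(1) show thesis by (rule that)
qed

lemma finite_bound:
  assumes "Well_order r" "Field r \<noteq> {}" "finite L" "L \<subseteq> Field r"
  shows "\<exists>a\<in>Field r. \<forall>b\<in>L. (b, a) \<in> r"
  using assms(3,4)
proof (induction L)
  case empty
  then show ?case using assms(2) by blast
next
  case (insert x L)
  then obtain a where a: "a \<in> Field r" "\<forall>b\<in>L. (b, a) \<in> r" by blast
  have lin: "total_on (Field r) r" "refl_on (Field r) r" "trans r"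
    using assms(1) by (auto simp: order_on_defs)
  show ?case
  proof (cases "(x, a) \<in> r")
    case True
    then show ?thesis using a by blast
  next
    case False
    then have "(a, x) \<in> r" "(x, x) \<in> r" "x \<in> Field r"
      using lin a(1) insert.prems unfolding total_on_def refl_on_def by (metis insert_subset)+
    then show ?thesis using a(2) lin(3) by (metis insertE transD)
  qed
qed

text \<open>\<open>cofinal\<close> is strict, so it would put an element of \<open>K\<close>
  strictly above an upper bound of a finite \<open>K\<close>.\<close>

lemma infinite_cofinal:
  assumes "Well_order r" "Field r \<noteq> {}" "K \<subseteq> Field r" "cofinal K r"
  shows "infinite K"
proof
  assume "finite K"
  then obtain a where a: "a \<in> Field r" "\<forall>b\<in>K. (b, a) \<in> r"
    using finite_bound[OF assms(1,2)] assms(3) by blast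
  then obtain b where "b \<in> K" "a \<noteq> b" "(a, b) \<in> r"
    using assms(4) unfolding cofinal_def by blast
  then show False
    using a(2) assms(1) by (auto simp: order_on_defs antisym_def)
qed

locale least_cofinal =
  fixes r :: "'a rel" and K :: "'a set"
  assumes r: "Cinfinite r"
    and K: "K \<subseteq> Field r"
    and cof: "cofinal K r"
    and least: "\<And>L. L \<subseteq> Field r \<Longrightarrow> cofinal L r \<Longrightarrow> |K| \<le>o |L|"
begin

lemma Well_order_r: "Well_order r"
  using r Card_order_Well_order by blast

lemma Field_r: "Field r \<noteq> {}"
  using r unfolding cinfinite_def by auto

lemma infinite_K: "infinite K"
  using infinite_cofinal[OF Well_order_r Field_r K cof] .

text \<open>Minimality of \<open>K\<close> prevents a smaller set from being cofinal. Both the count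
  of functions and the continuity of the embedding rest on this.\<close>

lemma small_bound:
  assumes "L \<subseteq> Field r" "|L| <o |K|"
  obtains a where "a \<in> Field r" "\<And>b. b \<in> L \<Longrightarrow> (b, a) \<in> r"
proof -
  have "\<not> cofinal L r"
    using least[OF assms(1)] assms(2) not_ordLess_ordLeq by blast
  with r assms(1) show thesis
    using not_cofinal_bound[of r L] that by blast
qed

lemma above: "\<exists>k\<in>K. a \<in> underS r k" if "a \<in> Field r"
  using cof that unfolding cofinal_def underS_def by blast

lemma card_of_K: "|K| \<le>o r"
  using r by (intro ordLeq_ordIso_trans[OF card_of_mono1[OF K] card_of_Field_ordIso]) blast

lemma card_of_Func_bounded_subsets:
  assumes "|R| <o |K|"
  shows "|Func (R :: 'a set) (bounded_subsets r)| \<le>o |bounded_subsets r|"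
proof -
  let ?c = "cexp_less ctwo r"
  let ?B = "bounded_subsets r"
  have c: "?c =o |?B|"
    using card_of_bounded_subsets[OF r] ordIso_symmetric by blast
  have rB: "r \<le>o |?B|"
    using ordLeq_cexp_less_ctwo[of r] r c ordLeq_ordIso_trans by blast
  have inf: "infinite ?B"
    using r cinfinite_mono[OF rB] by (simp add: cinfinite_def Field_card_of)
  have "Func R ?B \<subseteq> (\<Union>a\<in>Field r. Func R (Pow (underS r a)))"
  proof
    fix f assume f: "f \<in> Func R ?B"
    then have "\<forall>i\<in>R. \<exists>a\<in>Field r. f i \<subseteq> underS r a"
      unfolding Func_def bounded_subsets_def by blast
    \<comment> \<open>The bounds \<open>b i\<close> of the single values form a set smaller than
      \<open>K\<close>, so one \<open>a\<close> lies above all of them.\<close>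
    then obtain b where b: "\<And>i. i \<in> R \<Longrightarrow> b i \<in> Field r" "\<And>i. i \<in> R \<Longrightarrow> f i \<subseteq> underS r (b i)"
      by metis
    have "|b ` R| <o |K|"
      using ordLeq_ordLess_trans[OF card_of_image assms] .
    then obtain a where a: "a \<in> Field r" "\<And>x. x \<in> b ` R \<Longrightarrow> (x, a) \<in> r"
      using small_bound[of "b ` R"] b(1) by blast
    have "underS r (b i) \<subseteq> underS r a" if "i \<in> R" for i
      using a(2) that Well_order_r by (intro underS_incr) (auto simp: order_on_defs)
    then have "f \<in> Func R (Pow (underS r a))"
      using f b(2) unfolding Func_def by blast
    then show "f \<in> (\<Union>a\<in>Field r. Func R (Pow (underS r a)))"
      using a(1) by blast
  qed
  then have "|Func R ?B| \<le>o |\<Union>a\<in>Field r. Func R (Pow (underS r a))|"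
    by (rule card_of_mono1)
  also have "|\<Union>a\<in>Field r. Func R (Pow (underS r a))| \<le>o |?B|"
  proof (rule card_of_UNION_ordLeq_infinite[OF inf])
    show "|Field r| \<le>o |?B|"
      using r ordIso_ordLeq_trans[OF card_of_Field_ordIso rB] by blast
    show "\<forall>a\<in>Field r. |Func R (Pow (underS r a))| \<le>o |?B|"
    proof
      fix a assume a: "a \<in> Field r"
      \<comment> \<open>\<open>X\<close> absorbs both the exponent and the segment, each smaller
        than \<open>r\<close>; hence \<open>X \<times> X\<close> is still smaller than
        \<open>r\<close>, and its power set has size at most 2^{<r}.\<close>
      define X where "X = R \<union> underS r a"
      have "|R| <o r"
        using assms card_of_K by (rule ordLess_ordLeq_trans)
      then have "|X| <o r"
        unfolding X_def using r card_of_underS[of r a] a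
        by (intro card_of_Un_ordLess_infinite_Field) (auto simp: cinfinite_def)
      then have XX: "|X \<times> X| <o r"
        by (rule card_of_Times_same_ordLess[OF r])
      have "|Func R (Pow (underS r a))| \<le>o |Pow (X \<times> X)|"
      proof (rule card_of_ordLeqI)
        \<comment> \<open>A set-valued function is coded by the relation whose section at
          \<open>i\<close> is \<open>f i\<close>. Outside \<open>R\<close>, members of
          \<open>Func\<close> share a fixed default value.\<close>
        show "inj_on (\<lambda>f. SIGMA i : R. f i) (Func R (Pow (underS r a)))"
        proof (rule inj_onI)
          fix f g
          assume fg: "f \<in> Func R (Pow (underS r a))" "g \<in> Func R (Pow (underS r a))"
            and eq: "Sigma R f = Sigma R g"
          show "f = g"
          proof
            fix i
            show "f i = g i"
            proof (cases "i \<in> R")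
              case True
              then have "f i = Sigma R f `` {i}" "g i = Sigma R g `` {i}" by auto
              with eq show ?thesis by simp
            next
              case False
              with fg show ?thesis by (simp add: Func_def)
            qed
          qed
        qed
      qed (auto simp: X_def Func_def)
      also have "|Pow (X \<times> X)| \<le>o ?c"
        using r XX by (intro card_of_Pow_ordLeq_cexp_less) auto
      also have "?c =o |?B|" by (rule c)
      finally show "|Func R (Pow (underS r a))| \<le>o |?B|" .
    qed
  qed
  finally show ?thesis .
qed

end

section \<open>The bounded topology\<close>

lemma cone_set_mono:
  assumes "Well_order g" "(a, b) \<in> g"
  shows "cone_set g A b x \<subseteq> cone_set g A a x"
proof -
  have "underS g a \<subseteq> underS g b"
    using assms by (intro underS_incr) (auto simp: order_on_defs)
  then show ?thesis unfolding cone_set_def by blast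
qed

text \<open>The cones form a base: of two cones around the same point, the one given by the longer
  segment is contained in the other.\<close>

lemma openin_bounded_topology:
  assumes wo: "Well_order g" and ne: "Field g \<noteq> {}"
  shows "openin (bounded_topology g A) U \<longleftrightarrow>
    U \<subseteq> Field g \<rightarrow>\<^sub>E A \<and> (\<forall>x\<in>U. \<exists>a\<in>Field g. cone_set g A a x \<subseteq> U)"
proof
  let ?S = "insert (Field g \<rightarrow>\<^sub>E A)
       {cone_set g A a s | a s. a \<in> Field g \<and> s \<in> underS g a \<rightarrow>\<^sub>E A}"
  assume U: "openin (bounded_topology g A) U"
  then have "generate_topology_on ?S U"
    unfolding bounded_topology_def by (rule openin_topology_generated_by)
  then have "\<forall>x\<in>U. \<exists>a\<in>Field g. cone_set g A a x \<subseteq> U"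
  proof induction
    case Empty
    then show ?case by simp
  next
    case (Int U V)
    show ?case
    proof
      fix x assume "x \<in> U \<inter> V"
      then obtain a b where a: "a \<in> Field g" "cone_set g A a x \<subseteq> U"
        and b: "b \<in> Field g" "cone_set g A b x \<subseteq> V"
        using Int.IH by blast
      obtain c where "c \<in> Field g" "(a, c) \<in> g" "(b, c) \<in> g"
        using finite_bound[OF wo ne, of "{a, b}"] a(1) b(1) by auto
      then have "c \<in> Field g \<and> cone_set g A c x \<subseteq> U \<inter> V"
        using cone_set_mono[OF wo] a(2) b(2) by blast
      then show "\<exists>c\<in>Field g. cone_set g A c x \<subseteq> U \<inter> V" by blast
    qed
  next
    case (UN F)
    show ?case
    proof
      fix x assume "x \<in> \<Union>F"
      then obtain V where V: "V \<in> F" "x \<in> V" by blast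
      then obtain a where "a \<in> Field g" "cone_set g A a x \<subseteq> V"
        using UN.IH by blast
      with V(1) show "\<exists>a\<in>Field g. cone_set g A a x \<subseteq> \<Union>F" by blast
    qed
  next
    case (Basis V)
    then consider "V = Field g \<rightarrow>\<^sub>E A"
      | a s where "a \<in> Field g" "V = cone_set g A a s" by blast
    then show ?case
    proof cases
      case 1
      then show ?thesis using ne unfolding cone_set_def by blast
    next
      case 2
      have "cone_set g A a x \<subseteq> V" if "x \<in> V" for x
        using that unfolding 2(2) cone_set_def by auto
      with 2(1) show ?thesis by blast
    qed
  qed
  moreover have "U \<subseteq> Field g \<rightarrow>\<^sub>E A"
    using openin_subset[OF U] by (simp add: topspace_bounded_topology)
  ultimately show "U \<subseteq> Field g \<rightarrow>\<^sub>E A \<and> (\<forall>x\<in>U. \<exists>a\<in>Field g. cone_set g A a x \<subseteq> U)"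
    by blast
next
  assume U: "U \<subseteq> Field g \<rightarrow>\<^sub>E A \<and> (\<forall>x\<in>U. \<exists>a\<in>Field g. cone_set g A a x \<subseteq> U)"
  show "openin (bounded_topology g A) U"
  proof (subst openin_subopen, rule ballI)
    fix x assume x: "x \<in> U"
    with U obtain a where a: "a \<in> Field g" "cone_set g A a x \<subseteq> U" by blast
    have xA: "x \<in> Field g \<rightarrow>\<^sub>E A" using U x by blast
    have sub: "underS g a \<subseteq> Field g" by (auto simp: underS_def Field_def)
    \<comment> \<open>Generating cones are indexed by extensional sequences on the segment, so
      \<open>x\<close> has to be cut down to it.\<close>
    have "cone_set g A a x = cone_set g A a (restrict x (underS g a))"
      by (auto simp: cone_set_def)
    moreover have "restrict x (underS g a) \<in> underS g a \<rightarrow>\<^sub>E A"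
      using xA sub by auto
    ultimately have "openin (bounded_topology g A) (cone_set g A a x)"
      unfolding bounded_topology_def using a(1)
      by (intro topology_generated_by_Basis) blast
    moreover have "x \<in> cone_set g A a x"
      using xA unfolding cone_set_def by blast
    ultimately show "\<exists>T. openin (bounded_topology g A) T \<and> x \<in> T \<and> T \<subseteq> U"
      using a(2) by blast
  qed
qed

lemma openin_cone_set:
  assumes wo: "Well_order g" and a: "a \<in> Field g"
  shows "openin (bounded_topology g A) (cone_set g A a x)"
proof -
  have ne: "Field g \<noteq> {}" using a by blast
  have "cone_set g A a y \<subseteq> cone_set g A a x" if "y \<in> cone_set g A a x" for y
    using that unfolding cone_set_def by auto
  then show ?thesis
    unfolding openin_bounded_topology[OF wo ne] using a
    by (intro conjI ballI bexI[OF _ a]) (auto simp: cone_set_def)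
qed

text \<open>Continuity in terms of initial segments: \<open>f x\<close> below \<open>b\<close> is
  determined by \<open>x\<close> below some \<open>a\<close>. The subspace \<open>S\<close> lets the
  criterion serve an embedding and its inverse alike.\<close>

lemma continuous_map_bounded_topology:
  assumes g: "Well_order g" and h: "Well_order h" "Field h \<noteq> {}"
    and S: "S \<subseteq> Field g \<rightarrow>\<^sub>E A"
    and f: "f \<in> S \<rightarrow> (Field h \<rightarrow>\<^sub>E B)"
    and local: "\<And>x b. x \<in> S \<Longrightarrow> b \<in> Field h \<Longrightarrow>
      \<exists>a\<in>Field g. f ` (S \<inter> cone_set g A a x) \<subseteq> cone_set h B b (f x)"
  shows "continuous_map (subtopology (bounded_topology g A) S) (bounded_topology h B) f"
  unfolding continuous_map_def
proof (intro conjI allI impI)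
  have top: "topspace (subtopology (bounded_topology g A) S) = S"
    using S by (auto simp: topspace_bounded_topology)
  show "f \<in> topspace (subtopology (bounded_topology g A) S) \<rightarrow> topspace (bounded_topology h B)"
    using f unfolding top topspace_bounded_topology .
  fix U assume U: "openin (bounded_topology h B) U"
  show "openin (subtopology (bounded_topology g A) S)
      {x \<in> topspace (subtopology (bounded_topology g A) S). f x \<in> U}"
    unfolding top
  proof (subst openin_subopen, rule ballI)
    fix x assume "x \<in> {x \<in> S. f x \<in> U}"
    then have x: "x \<in> S" "f x \<in> U" by auto
    obtain b where b: "b \<in> Field h" "cone_set h B b (f x) \<subseteq> U"
      using U x(2) unfolding openin_bounded_topology[OF h] by blast
    obtain a where a: "a \<in> Field g" "f ` (S \<inter> cone_set g A a x) \<subseteq> cone_set h B b (f x)"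
      using local[OF x(1) b(1)] by blast
    have "openin (subtopology (bounded_topology g A) S) (S \<inter> cone_set g A a x)"
      using openin_cone_set[OF g a(1)] by (auto simp: openin_subtopology_alt)
    moreover have "x \<in> S \<inter> cone_set g A a x"
      using x(1) S unfolding cone_set_def by blast
    moreover have "S \<inter> cone_set g A a x \<subseteq> {x \<in> S. f x \<in> U}"
      using a(2) b(2) by blast
    ultimately show "\<exists>T. openin (subtopology (bounded_topology g A) S) T \<and> x \<in> T \<and>
        T \<subseteq> {x \<in> S. f x \<in> U}"
      by blast
  qed
qed

section \<open>The embedding\<close>

context least_cofinal
begin

text \<open>An infinite cardinal is a limit, so there is room strictly above any finite set. Thus a
  single cone can fix finitely many coordinates.\<close>

lemma underS_K_above:
  assumes "finite J" "J \<subseteq> K"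
  shows "\<exists>m\<in>K. J \<subseteq> underS |K| m"
proof -
  have wo: "Well_order |K|" by (rule card_of_Well_order)
  have ne: "Field |K| \<noteq> {}" using infinite_K by (auto simp: Field_card_of)
  obtain a where a: "a \<in> K" "\<forall>b\<in>J. (b, a) \<in> |K|"
    using finite_bound[OF wo ne assms(1)] assms(2) by (auto simp: Field_card_of)
  obtain m where m: "m \<in> K" "a \<noteq> m" "(a, m) \<in> |K|"
    using infinite_Card_order_limit[of "|K|" a] a(1) infinite_K
    by (auto simp: Field_card_of card_of_card_order_on)
  have "trans |K|" "antisym |K|"
    using wo by (auto simp: order_on_defs)
  then have "b \<in> underS |K| m" if "b \<in> J" for b
    using a(2) m(2,3) that unfolding underS_def trans_def antisym_def by blast
  with m(1) show ?thesis by blast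
qed

lemma closed_embedding:
  assumes h: "bij_betw h (bounded_subsets r) D"
  shows "\<exists>C. closedin (bounded_topology |K| D) C \<and>
    bounded_topology r (UNIV :: bool set) homeomorphic_space
      subtopology (bounded_topology |K| D) C"
proof -
  let ?X = "Field r \<rightarrow>\<^sub>E (UNIV :: bool set)" and ?Y = "K \<rightarrow>\<^sub>E D"
  let ?TX = "bounded_topology r (UNIV :: bool set)" and ?TY = "bounded_topology |K| D"
  have woK: "Well_order |K|" by (rule card_of_Well_order)
  have neK: "Field |K| \<noteq> {}" using infinite_K by (auto simp: Field_card_of)
  define code where "code = the_inv_into (bounded_subsets r) h"
  have code_h: "code (h s) = s" if "s \<in> bounded_subsets r" for s
    using h that unfolding code_def bij_betw_def by (simp add: the_inv_into_f_f)
  have h_code: "h (code d) = d" if "d \<in> D" for d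
    using h that unfolding code_def bij_betw_def by (simp add: f_the_inv_into_f)
  \<comment> \<open>\<open>\<kappa> i\<close> selects a coordinate whose segment contains
    \<open>i\<close>, from which bit \<open>i\<close> can be read off.\<close>
  obtain \<kappa> where \<kappa>: "\<And>i. i \<in> Field r \<Longrightarrow> \<kappa> i \<in> K" "\<And>i. i \<in> Field r \<Longrightarrow> i \<in> underS r (\<kappa> i)"
    using above by metis
  have underS_F: "underS r k \<subseteq> Field r" for k by (auto simp: underS_def Field_def)
  define \<phi> where "\<phi> x = (\<lambda>k\<in>K. h {i \<in> underS r k. x i})" for x :: "'a \<Rightarrow> bool"
  define \<psi> where "\<psi> y = (\<lambda>i\<in>Field r. i \<in> code (y (\<kappa> i)))" for y
  \<comment> \<open>Coherence: coordinate \<open>k\<close> codes a subset of its own segment and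
    agrees at every \<open>i\<close> there with the designated coordinate
    \<open>\<kappa> i\<close>.\<close>
  define C where "C = {y \<in> ?Y. \<forall>k\<in>K. \<forall>i.
    i \<in> code (y k) \<longleftrightarrow> i \<in> underS r k \<and> i \<in> code (y (\<kappa> i))}"
  have bdd: "{i \<in> underS r k. x i} \<in> bounded_subsets r" if "k \<in> K" for x k
    using that K unfolding bounded_subsets_def by blast
  have code_\<phi>: "code (\<phi> x k) = {i \<in> underS r k. x i}" if "k \<in> K" for x k
    unfolding \<phi>_def using that by (simp add: code_h[OF bdd])
  have \<phi>_Y: "\<phi> x \<in> ?Y" for x
    unfolding \<phi>_def using bij_betwE[OF h] bdd by auto
  have \<phi>_C: "\<phi> x \<in> C" for x
  proof -
    have "i \<in> code (\<phi> x k) \<longleftrightarrow> i \<in> underS r k \<and> i \<in> code (\<phi> x (\<kappa> i))" if "k \<in> K" for k i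
    proof (cases "i \<in> underS r k")
      case True
      then have "i \<in> Field r" using underS_F by blast
      then show ?thesis using True that by (simp add: code_\<phi> \<kappa>)
    next
      case False
      then show ?thesis using that by (simp add: code_\<phi>)
    qed
    with \<phi>_Y show ?thesis unfolding C_def by simp
  qed
  have \<psi>_X: "\<psi> y \<in> ?X" for y
    unfolding \<psi>_def by auto
  have \<psi>\<phi>: "\<psi> (\<phi> x) = x" if "x \<in> ?X" for x
  proof
    fix i
    show "\<psi> (\<phi> x) i = x i"
      using that \<kappa>[of i] by (cases "i \<in> Field r") (auto simp: \<psi>_def code_\<phi> PiE_def extensional_def)
  qed
  have \<phi>\<psi>: "\<phi> (\<psi> y) = y" if "y \<in> C" for y
  proof
    fix k
    have y: "y \<in> ?Y" "\<And>k i. k \<in> K \<Longrightarrow> i \<in> code (y k) \<longleftrightarrow> i \<in> underS r k \<and> i \<in> code (y (\<kappa> i))"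
      using that unfolding C_def by blast+
    show "\<phi> (\<psi> y) k = y k"
    proof (cases "k \<in> K")
      case True
      have "{i \<in> underS r k. \<psi> y i} = code (y k)"
        using y(2)[OF True] underS_F unfolding \<psi>_def by auto
      moreover have "y k \<in> D" using y(1) True by blast
      ultimately show ?thesis
        unfolding \<phi>_def using True h_code by simp
    next
      case False
      then show ?thesis using y(1) unfolding \<phi>_def by (auto simp: PiE_def extensional_def)
    qed
  qed
  have "closedin ?TY C"
    unfolding closedin_def
  proof
    show "C \<subseteq> topspace ?TY"
      unfolding topspace_bounded_topology C_def by (auto simp: Field_card_of)
    show "openin ?TY (topspace ?TY - C)"
      unfolding openin_bounded_topology[OF woK neK] topspace_bounded_topology Field_card_of
    proof (intro conjI ballI)
      fix y assume y: "y \<in> ?Y - C"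
      then obtain k i where ki: "k \<in> K"
        "\<not> (i \<in> code (y k) \<longleftrightarrow> i \<in> underS r k \<and> i \<in> code (y (\<kappa> i)))"
        unfolding C_def by blast
      \<comment> \<open>A failing condition puts \<open>i\<close> into \<open>code (y k)\<close> or
        \<open>underS r k\<close>. Both lie in \<open>Field r\<close>, so \<open>\<kappa> i\<close>
        is a genuine coordinate. The failure depends on the coordinates \<open>k\<close> and
        \<open>\<kappa> i\<close> only, so a cone fixing these two misses \<open>C\<close>.\<close>
      obtain b where "b \<in> Field r" "code (y k) \<subseteq> underS r b"
      proof -
        have "y k \<in> D" using y ki(1) by blast
        then have "code (y k) \<in> bounded_subsets r"
          using h unfolding code_def bij_betw_def
          by (metis the_inv_into_into subset_refl)
        then show thesis using that unfolding bounded_subsets_def by blast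
      qed
      with ki(2) have "i \<in> Field r" using underS_F by blast
      then have "{k, \<kappa> i} \<subseteq> K" using ki(1) \<kappa>(1) by blast
      then obtain m where m: "m \<in> K" "{k, \<kappa> i} \<subseteq> underS |K| m"
        using underS_K_above[of "{k, \<kappa> i}"] by auto
      have "z \<notin> C" if "z \<in> cone_set |K| D m y" for z
      proof -
        have "z k = y k" "z (\<kappa> i) = y (\<kappa> i)"
          using that m(2) unfolding cone_set_def by auto
        with ki(2) have "\<not> (i \<in> code (z k) \<longleftrightarrow> i \<in> underS r k \<and> i \<in> code (z (\<kappa> i)))"
          by simp
        with ki(1) show ?thesis unfolding C_def by blast
      qed
      then have "cone_set |K| D m y \<subseteq> ?Y - C"
        by (auto simp: cone_set_def Field_card_of)
      with m(1) show "\<exists>m\<in>K. cone_set |K| D m y \<subseteq> ?Y - C" by blast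
    qed blast
  qed
  moreover have "homeomorphic_maps ?TX (subtopology ?TY C) \<phi> \<psi>"
    unfolding homeomorphic_maps_def
  proof (intro conjI)
    have "continuous_map (subtopology ?TX ?X) ?TY \<phi>"
    proof (rule continuous_map_bounded_topology[OF Well_order_r woK neK subset_refl])
      show "\<phi> \<in> ?X \<rightarrow> (Field |K| \<rightarrow>\<^sub>E D)" using \<phi>_Y by (auto simp: Field_card_of)
      fix x b assume "b \<in> Field |K|"
      \<comment> \<open>Fewer than \<open>|K|\<close> coordinates precede \<open>b\<close>, so they
        are bounded in \<open>r\<close> by some \<open>a\<close>, and \<open>x\<close> below
        \<open>a\<close> determines all of them.\<close>
      then have "|underS |K| b| <o |K|"
        by (intro card_of_underS card_of_Card_order)
      moreover have uK: "underS |K| b \<subseteq> K"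
        using Field_card_of[of K] by (auto simp: underS_def Field_def)
      ultimately obtain a where a: "a \<in> Field r" "\<And>j. j \<in> underS |K| b \<Longrightarrow> (j, a) \<in> r"
        using small_bound K by blast
      have "\<phi> z \<in> cone_set |K| D b (\<phi> x)" if z: "z \<in> cone_set r UNIV a x" for z
      proof -
        have "\<phi> z j = \<phi> x j" if j: "j \<in> underS |K| b" for j
        proof -
          have "underS r j \<subseteq> underS r a"
            using a(2)[OF j] Well_order_r by (intro underS_incr) (auto simp: order_on_defs)
          then have "{i \<in> underS r j. z i} = {i \<in> underS r j. x i}"
            using z unfolding cone_set_def by auto
          then show ?thesis unfolding \<phi>_def by simp
        qed
        then show ?thesis using \<phi>_Y unfolding cone_set_def by (simp add: Field_card_of)
      qed
      with a(1) show "\<exists>a\<in>Field r. \<phi> ` (?X \<inter> cone_set r UNIV a x) \<subseteq> cone_set |K| D b (\<phi> x)"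
        by blast
    qed
    then have "continuous_map ?TX ?TY \<phi>"
      using subtopology_topspace[of ?TX] by (simp add: topspace_bounded_topology)
    then show "continuous_map ?TX (subtopology ?TY C) \<phi>"
      using \<phi>_C by (auto simp: continuous_map_in_subtopology)
    show "continuous_map (subtopology ?TY C) ?TX \<psi>"
    proof (rule continuous_map_bounded_topology[OF woK Well_order_r Field_r])
      show "C \<subseteq> Field |K| \<rightarrow>\<^sub>E D" unfolding C_def by (auto simp: Field_card_of)
      show "\<psi> \<in> C \<rightarrow> ?X" using \<psi>_X by blast
      fix y a assume y: "y \<in> C" and a: "a \<in> Field r"
      \<comment> \<open>One coordinate \<open>k\<close> above \<open>a\<close> carries all bits
        below \<open>a\<close>: on \<open>C\<close>, coherence allows reading bit \<open>i\<close>
        from \<open>k\<close> instead of \<open>\<kappa> i\<close>.\<close>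
      obtain k where k: "k \<in> K" "a \<in> underS r k" using above[OF a] by blast
      obtain m where m: "m \<in> K" "k \<in> underS |K| m"
        using underS_K_above[of "{k}"] k(1) by auto
      have sub: "underS r a \<subseteq> underS r k"
        using k(2) Well_order_r by (intro underS_incr) (auto simp: order_on_defs underS_def)
      have "\<psi> z \<in> cone_set r UNIV a (\<psi> y)" if z: "z \<in> C" "z \<in> cone_set |K| D m y" for z
      proof -
        have zk: "z k = y k" using z(2) m(2) unfolding cone_set_def by blast
        have "\<psi> z i = \<psi> y i" if i: "i \<in> underS r a" for i
        proof -
          have "i \<in> underS r k" using i sub by blast
          then have "\<psi> w i \<longleftrightarrow> i \<in> code (w k)" if "w \<in> C" for w
            using that k(1) underS_F[of k] unfolding C_def \<psi>_def by auto
          then show ?thesis using y z(1) zk by metis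
        qed
        then show ?thesis using \<psi>_X unfolding cone_set_def by blast
      qed
      with m(1) show "\<exists>m\<in>Field |K|. \<psi> ` (C \<inter> cone_set |K| D m y) \<subseteq> cone_set r UNIV a (\<psi> y)"
        by (auto simp: Field_card_of)
    qed
    show "\<forall>x\<in>topspace ?TX. \<psi> (\<phi> x) = x"
      using \<psi>\<phi> by (simp add: topspace_bounded_topology)
    show "\<forall>y\<in>topspace (subtopology ?TY C). \<phi> (\<psi> y) = y"
      using \<phi>\<psi> by simp
  qed
  ultimately show ?thesis
    unfolding homeomorphic_space_def by blast
qed

end

theorem proposition2p8:
  fixes lam :: "'a rel" and lam' :: "('a \<Rightarrow> bool) rel"
  assumes "Cinfinite lam"
    and "lam' = cexp_less ctwo lam"
  shows "cexp_less lam' (cofinality lam) =o lam' \<and>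
    (\<exists>C. closedin (bounded_topology (cofinality lam) (Field lam')) C \<and>
      bounded_topology lam (UNIV :: bool set) homeomorphic_space
        subtopology (bounded_topology (cofinality lam) (Field lam')) C)"
proof -
  obtain K where wit: "K \<subseteq> Field lam" "cofinal K lam" "cofinality lam = |K|"
    "\<And>L. L \<subseteq> Field lam \<Longrightarrow> cofinal L lam \<Longrightarrow> |K| \<le>o |L|"
    by (rule cofinality_witness[OF assms(1)]) (rule that)
  interpret least_cofinal lam K
    using assms(1) wit(1,2,4) by (rule least_cofinal.intro)
  let ?B = "bounded_subsets lam"
  have lam': "Card_order lam'"
    using is_csup_cexp_less[of ctwo lam] unfolding assms(2) is_csup_def by blast
  have B: "|?B| =o lam'"
    unfolding assms(2) by (rule card_of_bounded_subsets[OF assms(1)])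
  have B': "|?B| =o |Field lam'|"
    using card_of_cong[OF B] by (simp add: Field_card_of)
  let ?R = "{lam' ^c \<rho> | \<rho> :: 'a rel. Card_order \<rho> \<and> \<rho> <o |K|}"
  have sup: "is_csup ?R (cexp_less lam' |K| )"
    by (rule is_csup_cexp_less)
  have "cexp_less lam' |K| \<le>o lam'"
  proof (rule is_csup_least[OF sup lam'])
    fix q assume "q \<in> ?R"
    then obtain \<rho> :: "'a rel" where \<rho>: "q = lam' ^c \<rho>" "Card_order \<rho>" "\<rho> <o |K|" by blast
    \<comment> \<open>Replacing the base by \<open>|?B|\<close> makes the power a set of functions
      into bounded subsets.\<close>
    have "q =o |?B| ^c \<rho>"
      unfolding \<rho>(1) using ordIso_symmetric[OF B] \<rho>(2) by (rule cexp_cong1)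
    also have "|?B| ^c \<rho> = |Func (Field \<rho>) ?B|"
      by (simp add: cexp_def Field_card_of)
    also have "|Func (Field \<rho>) ?B| \<le>o |?B|"
      using ordIso_ordLess_trans[OF card_of_Field_ordIso[OF \<rho>(2)] \<rho>(3)]
      by (rule card_of_Func_bounded_subsets)
    also have "|?B| =o lam'" by (rule B)
    finally show "q \<le>o lam'" .
  qed
  moreover have "lam' \<le>o cexp_less lam' |K|"
  proof -
    \<comment> \<open>A singleton supplies the exponent 1, which is below the infinite
      cofinality.\<close>
    obtain k where k: "k \<in> K" using infinite_K by fastforce
    have "|{k}| <o |K|"
      using infinite_K
      by (intro Cfinite_ordLess_Cinfinite)
        (auto simp: cfinite_def cinfinite_def Field_card_of card_of_card_order_on)
    then have "lam' ^c |{k}| \<in> ?R"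
      using card_of_Card_order by blast
    then have "lam' ^c |{k}| \<le>o cexp_less lam' |K|"
      using sup unfolding is_csup_def by blast
    moreover have "lam' \<le>o lam' ^c |{k}|"
      using lam' by (intro ordLeq_cexp1)
        (auto simp: card_of_Card_order card_of_ordIso_czero_iff_empty)
    ultimately show ?thesis by (rule ordLeq_transitive[rotated])
  qed
  ultimately have "cexp_less lam' |K| =o lam'"
    by (simp add: ordIso_iff_ordLeq)
  moreover obtain h where "bij_betw h ?B (Field lam')"
    using B' card_of_ordIso by blast
  ultimately show ?thesis
    unfolding wit(3) using closed_embedding by blast
qed

end
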